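(* For every real $p>0$, the set $L_{p}[0,1]\setminus\bigcup_{q\in(p,\infty)}L_{q}[0,1]$ is pointwise maximal dense-lineable in $L_p[0,1]$.
   Context: $\mathbb{K}$ denotes $\mathbb{R}$ or $\mathbb{C}$; $L_p[0,1]$ is the usual Lebesgue space of (classes of) $\mathbb{K}$-valued functions on $[0,1]$ with its usual norm ($p\ge1$) or $p$-norm ($0<p<1$) topology. Dimension means algebraic (Hamel) dimension. If $V$ is a vector space endowed with a topology, a non-void subset $A\subset V$ is pointwise maximal dense-lineable if for each $x\in A$ there is a dense subspace $W_x$ of $V$ with $\dim W_x=\dim V$ and $x\in W_x\subset A\cup\{0\}$. *)

theory Defs
  imports "HOL-Analysis.Analysis" "HOL-Library.Equipollence"
begin

section \<open>Pointwise maximal dense-lineability\<close>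

text \<open>
  The library's \<open>dim\<close> is a natural number (and \<open>0\<close> for infinite-dimensional spaces), so equality of
  Hamel dimensions is expressed by equipollence of Hamel bases. The cardinality of a Hamel basis
  does not depend on the basis.
\<close>

definition same_hamel_dim ::
  "('k::field \<Rightarrow> 'v::ab_group_add \<Rightarrow> 'v) \<Rightarrow> 'v set \<Rightarrow> 'v set \<Rightarrow> bool" where
  "same_hamel_dim smul V W \<longleftrightarrow>
     (\<exists>B C. \<not> module.dependent smul B \<and> module.span smul B = V \<and>
            \<not> module.dependent smul C \<and> module.span smul C = W \<and> B \<approx> C)"

text \<open>
  The space \<open>V\<close> is the carrier \<open>topspace T\<close>, meant to be a linear subspace of the ambient type.
\<close>

definition pointwise_maximal_dense_lineable ::
  "('k::field \<Rightarrow> 'v::ab_group_add \<Rightarrow> 'v) \<Rightarrow> 'v topology \<Rightarrow> 'v set \<Rightarrow> bool" where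
  "pointwise_maximal_dense_lineable smul T A \<longleftrightarrow>
     A \<noteq> {} \<and> A \<subseteq> topspace T \<and>
     (\<forall>x\<in>A. \<exists>W. module.subspace smul W \<and> T closure_of W = topspace T \<and>
        same_hamel_dim smul W (topspace T) \<and> x \<in> W \<and> W \<subseteq> A \<union> {0})"


section \<open>Classes of measurable functions on the unit interval\<close>

abbreviation unit_lebesgue :: "real measure" where
  "unit_lebesgue \<equiv> lebesgue_on {0..1}"

definition ae_equal ::
  "(real \<Rightarrow> 'k) \<Rightarrow> (real \<Rightarrow> 'k::{real_normed_field, second_countable_topology}) \<Rightarrow> bool" where
  "ae_equal f g \<longleftrightarrow> f \<in> borel_measurable unit_lebesgue \<and> g \<in> borel_measurable unit_lebesgue \<and>
     (AE x in unit_lebesgue. f x = g x)"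

text \<open>
  Partial quotient: only measurable functions have a class. Values outside \<open>{0..1}\<close> are irrelevant.
\<close>

quotient_type (overloaded) 'k L0 =
  "real \<Rightarrow> 'k::{real_normed_field, second_countable_topology}" / partial: ae_equal
proof (rule part_equivpI)
  show "\<exists>f :: real \<Rightarrow> 'k. ae_equal f f"
    by (rule exI[of _ "\<lambda>_. 0"]) (simp add: ae_equal_def)
  show "symp (ae_equal :: (real \<Rightarrow> 'k) \<Rightarrow> _)"
    by (auto simp: symp_def ae_equal_def)
  show "transp (ae_equal :: (real \<Rightarrow> 'k) \<Rightarrow> _)"
    unfolding transp_def ae_equal_def by (auto elim: AE_mp)
qed

instantiation L0 :: ("{real_normed_field, second_countable_topology}") ab_group_add
begin

lift_definition zero_L0 :: "'a L0" is "\<lambda>_. 0"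
  by (simp add: ae_equal_def)

lift_definition plus_L0 :: "'a L0 \<Rightarrow> 'a L0 \<Rightarrow> 'a L0" is "\<lambda>f g x. f x + g x"
  by (auto simp: ae_equal_def elim: AE_mp)

lift_definition uminus_L0 :: "'a L0 \<Rightarrow> 'a L0" is "\<lambda>f x. - f x"
  by (auto simp: ae_equal_def elim: AE_mp)

lift_definition minus_L0 :: "'a L0 \<Rightarrow> 'a L0 \<Rightarrow> 'a L0" is "\<lambda>f g x. f x - g x"
  by (auto simp: ae_equal_def elim: AE_mp)

instance
  by standard (transfer; auto simp: ae_equal_def algebra_simps)+

end

lift_definition scale_L0 ::
  "'k \<Rightarrow> 'k L0 \<Rightarrow> 'k::{real_normed_field, second_countable_topology} L0" is "\<lambda>c f x. c * f x"
  by (auto simp: ae_equal_def elim: AE_mp)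

lemma vector_space_scale_L0: "vector_space scale_L0"
  by standard (transfer; auto simp: ae_equal_def algebra_simps)+


section \<open>The spaces \<open>L\<^sub>p[0,1]\<close>\<close>

lift_definition in_Lp :: "real \<Rightarrow> 'k::{real_normed_field, second_countable_topology} L0 \<Rightarrow> bool" is
  "\<lambda>p f. integrable unit_lebesgue (\<lambda>x. norm (f x) powr p)"
  unfolding ae_equal_def by (intro integrable_cong_AE) auto

definition Lp :: "real \<Rightarrow> 'k::{real_normed_field, second_countable_topology} L0 set" where
  "Lp p = {f. in_Lp p f}"

lift_definition p_integral :: "real \<Rightarrow> 'k::{real_normed_field, second_countable_topology} L0 \<Rightarrow> real" is
  "\<lambda>p f. LINT x|unit_lebesgue. norm (f x) powr p"
  unfolding ae_equal_def by (intro integral_cong_AE) auto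

text \<open>
  The metric of the \<open>L\<^sub>p\<close> norm for \<open>p \<ge> 1\<close>, and of the \<open>p\<close>-norm, which has no
  \<open>p\<close>-th root, for \<open>0 < p < 1\<close>.
\<close>

definition Lp_norm :: "real \<Rightarrow> 'k::{real_normed_field, second_countable_topology} L0 \<Rightarrow> real" where
  "Lp_norm p f = (if p \<ge> 1 then p_integral p f powr (1 / p) else p_integral p f)"

definition Lp_dist ::
  "real \<Rightarrow> 'k L0 \<Rightarrow> 'k::{real_normed_field, second_countable_topology} L0 \<Rightarrow> real" where
  "Lp_dist p f g = Lp_norm p (f - g)"

definition Lp_topology ::
  "real \<Rightarrow> 'k::{real_normed_field, second_countable_topology} L0 topology" where
  "Lp_topology p = Metric_space.mtopology (Lp p) (Lp_dist p)"


subsection \<open>\<open>L\<^sub>p[0,1]\<close> is a linear subspace, and the distance is a metric on it\<close>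

lemma powr_add_le_powr_add:
  fixes a b p :: real
  assumes "0 \<le> a" "0 \<le> b" "0 < p" "p \<le> 1"
  shows "(a + b) powr p \<le> a powr p + b powr p"
proof (cases "a + b = 0")
  case False
  then have s: "a + b > 0" using assms by simp
  have *: "t \<le> t powr p" if "0 \<le> t" "t \<le> 1" for t :: real
    using powr_mono'[of p 1 t] that assms by (cases "t = 0") auto
  have "1 = a / (a + b) + b / (a + b)"
    using s by (simp add: add_divide_distrib[symmetric])
  also have "\<dots> \<le> (a / (a + b)) powr p + (b / (a + b)) powr p"
    using s assms by (intro add_mono *) (auto simp: field_simps)
  also have "\<dots> = (a powr p + b powr p) / (a + b) powr p"
    using s assms by (simp add: powr_divide add_divide_distrib)
  finally show ?thesis
    using s by (simp add: field_simps)
qed (use assms in auto)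

lemma powr_convex_nonneg:
  fixes a b u v p :: real
  assumes "0 \<le> a" "0 \<le> b" "0 \<le> u" "0 \<le> v" "u + v = 1" "1 \<le> p"
  shows "(u * a + v * b) powr p \<le> u * a powr p + v * b powr p"
proof -
  have *: "t powr p \<le> t" if "0 \<le> t" "t \<le> 1" for t :: real
    using powr_mono'[of 1 p t] that assms by (cases "t = 0") auto
  have "(w * c) powr p \<le> w * c powr p" if "0 \<le> w" "w \<le> 1" "0 \<le> c" for w c :: real
    using *[of w] that by (simp add: powr_mult mult_right_mono)
  note z = this
  consider "a = 0" | "b = 0" | "a > 0" "b > 0" using assms by linarith
  then show ?thesis
  proof cases
    case 1
    then show ?thesis using z[of v b] assms by simp
  next
    case 2
    then show ?thesis using z[of u a] assms by simp
  next
    case 3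
    have "convex_on {0<..} (\<lambda>x::real. x powr p)"
      by (rule powr_convex) fact
    from convex_onD[OF this, of v a b] 3 assms show ?thesis
      by (simp add: eq_diff_eq[symmetric])
  qed
qed

lemma powr_add_le_crude:
  fixes a b p :: real
  assumes "0 \<le> a" "0 \<le> b" "0 < p"
  shows "(a + b) powr p \<le> 2 powr p * (a powr p + b powr p)"
proof -
  have "(a + b) powr p \<le> (2 * max a b) powr p"
    using assms by (intro powr_mono2) auto
  also have "\<dots> = 2 powr p * max a b powr p"
    using assms by (simp add: powr_mult)
  also have "\<dots> \<le> 2 powr p * (a powr p + b powr p)"
    by (intro mult_left_mono) (auto simp: max_def)
  finally show ?thesis .
qed

lemma in_Lp_add:
  assumes "0 < p" "in_Lp p f" "in_Lp p g"
  shows "in_Lp p (f + g)"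
  using assms(2,3)
proof (transfer fixing: p)
  fix f g :: "real \<Rightarrow> 'a"
  assume m: "ae_equal f f" "ae_equal g g"
    and i: "integrable unit_lebesgue (\<lambda>x. norm (f x) powr p)"
           "integrable unit_lebesgue (\<lambda>x. norm (g x) powr p)"
  have "integrable unit_lebesgue (\<lambda>x. 2 powr p * (norm (f x) powr p + norm (g x) powr p))"
    using i by auto
  then show "integrable unit_lebesgue (\<lambda>x. norm (f x + g x) powr p)"
  proof (rule Bochner_Integration.integrable_bound)
    show "(\<lambda>x. norm (f x + g x) powr p) \<in> borel_measurable unit_lebesgue"
      using m by (auto simp: ae_equal_def)
    have "norm (f x + g x) powr p \<le> 2 powr p * (norm (f x) powr p + norm (g x) powr p)" for x
      using powr_mono2[of p "norm (f x + g x)" "norm (f x) + norm (g x)"] \<open>0 < p\<close>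
        powr_add_le_crude[of "norm (f x)" "norm (g x)" p] norm_triangle_ineq[of "f x" "g x"]
      by force
    then show "AE x in unit_lebesgue. norm (norm (f x + g x) powr p) \<le>
        norm (2 powr p * (norm (f x) powr p + norm (g x) powr p))"
      by (auto intro!: AE_I2 order_trans[OF _ abs_ge_self])
  qed
qed

lemma in_Lp_scale: "in_Lp p f \<Longrightarrow> in_Lp p (scale_L0 c f)"
  by transfer (simp add: norm_mult powr_mult)

lemma in_Lp_0: "0 < p \<Longrightarrow> in_Lp p 0"
  by transfer simp

lemma subspace_Lp:
  assumes "0 < p"
  shows "module.subspace scale_L0 (Lp p)"
proof -
  interpret vector_space "scale_L0 :: 'a \<Rightarrow> _" by (rule vector_space_scale_L0)
  show ?thesis
    using assms by (auto simp: subspace_def Lp_def in_Lp_0 in_Lp_add in_Lp_scale)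
qed

lemma p_integral_nonneg: "0 \<le> p_integral p f"
  by transfer simp

lemma p_integral_eq_0_iff:
  assumes "0 < p" "in_Lp p f"
  shows "p_integral p f = 0 \<longleftrightarrow> f = 0"
  using assms(2)
proof (transfer fixing: p)
  fix f :: "real \<Rightarrow> 'a"
  assume m: "ae_equal f f" and i: "integrable unit_lebesgue (\<lambda>x. norm (f x) powr p)"
  have "(LINT x|unit_lebesgue. norm (f x) powr p) = 0 \<longleftrightarrow>
      (AE x in unit_lebesgue. norm (f x) powr p = 0)"
    by (rule integral_nonneg_eq_0_iff_AE[OF i]) auto
  also have "\<dots> \<longleftrightarrow> ae_equal f (\<lambda>_. 0)"
    using m by (simp add: ae_equal_def)
  finally show "(LINT x|unit_lebesgue. norm (f x) powr p) = 0 \<longleftrightarrow> ae_equal f (\<lambda>_. 0)" .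
qed

lemma p_integral_minus: "p_integral p (- f) = p_integral p f"
  by transfer simp

lemma p_integral_add_le:
  assumes "0 < p" "p \<le> 1" "in_Lp p f" "in_Lp p g"
  shows "p_integral p (f + g) \<le> p_integral p f + p_integral p g"
  using assms(3,4) in_Lp_add[OF assms(1,3,4)]
proof (transfer fixing: p)
  fix f g :: "real \<Rightarrow> 'a"
  assume i: "integrable unit_lebesgue (\<lambda>x. norm (f x) powr p)"
      "integrable unit_lebesgue (\<lambda>x. norm (g x) powr p)"
      "integrable unit_lebesgue (\<lambda>x. norm (f x + g x) powr p)"
  have "norm (f x + g x) powr p \<le> norm (f x) powr p + norm (g x) powr p" for x
    using powr_mono2[of p "norm (f x + g x)" "norm (f x) + norm (g x)"] assms
      powr_add_le_powr_add[of "norm (f x)" "norm (g x)" p] norm_triangle_ineq[of "f x" "g x"]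
    by force
  then have "(LINT x|unit_lebesgue. norm (f x + g x) powr p)
      \<le> (LINT x|unit_lebesgue. norm (f x) powr p + norm (g x) powr p)"
    using i by (intro integral_mono) auto
  then show "(LINT x|unit_lebesgue. norm (f x + g x) powr p)
      \<le> (LINT x|unit_lebesgue. norm (f x) powr p) + (LINT x|unit_lebesgue. norm (g x) powr p)"
    using i by simp
qed

lemma p_integral_add_convex:
  assumes "1 \<le> p" "in_Lp p f" "in_Lp p g" "0 < a" "0 < b"
  shows "p_integral p (f + g) \<le>
    (a + b) powr p * (a / (a + b) * (p_integral p f / a powr p) + b / (a + b) * (p_integral p g / b powr p))"
  using assms(2,3) in_Lp_add[OF _ assms(2,3)]
proof (transfer fixing: p a b)
  fix f g :: "real \<Rightarrow> 'a"
  let ?M = unit_lebesgue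
  assume i: "integrable ?M (\<lambda>x. norm (f x) powr p)" "integrable ?M (\<lambda>x. norm (g x) powr p)"
    and i3: "0 < p \<Longrightarrow> integrable ?M (\<lambda>x. norm (f x + g x) powr p)"
  let ?h = "\<lambda>x. (a + b) powr p *
    (a / (a + b) * (norm (f x) powr p / a powr p) + b / (a + b) * (norm (g x) powr p / b powr p))"
  have "norm (f x + g x) powr p \<le> ?h x" for x
  proof -
    let ?c = "a / (a + b) * (norm (f x) / a) + b / (a + b) * (norm (g x) / b)"
    have c: "(a + b) * ?c = norm (f x) + norm (g x)"
      using assms by (simp add: distrib_left)
    have "norm (f x + g x) powr p \<le> ((a + b) * ?c) powr p"
      unfolding c using assms by (intro powr_mono2 norm_triangle_ineq) auto
    also have "\<dots> = (a + b) powr p * ?c powr p"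
      using assms by (simp add: powr_mult)
    also have "\<dots> \<le> (a + b) powr p *
      (a / (a + b) * (norm (f x) / a) powr p + b / (a + b) * (norm (g x) / b) powr p)"
      using assms
      by (intro mult_left_mono powr_convex_nonneg) (auto simp: add_divide_distrib[symmetric])
    finally show ?thesis
      using assms by (simp add: powr_divide)
  qed
  then have "(LINT x|?M. norm (f x + g x) powr p) \<le> (LINT x|?M. ?h x)"
    using i i3 assms by (intro integral_mono) auto
  then show "(LINT x|?M. norm (f x + g x) powr p) \<le>
     (a + b) powr p * (a / (a + b) * ((LINT x|?M. norm (f x) powr p) / a powr p) +
       b / (a + b) * ((LINT x|?M. norm (g x) powr p) / b powr p))"
    using i by simp
qed

lemma Lp_norm_add_le:
  assumes "0 < p" "in_Lp p f" "in_Lp p g"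
  shows "Lp_norm p (f + g) \<le> Lp_norm p f + Lp_norm p g"
proof (cases "1 \<le> p")
  case False
  then show ?thesis
    using p_integral_add_le[of p f g] assms by (simp add: Lp_norm_def)
next
  case True
  let ?a = "p_integral p f powr (1 / p)" and ?b = "p_integral p g powr (1 / p)"
  consider "f = 0" | "g = 0" | "f \<noteq> 0" "g \<noteq> 0" by blast
  then show ?thesis
  proof cases
    case 3
    then have pos: "p_integral p f > 0" "p_integral p g > 0"
      using p_integral_nonneg[of p f] p_integral_nonneg[of p g] assms
      by (auto simp: p_integral_eq_0_iff less_le)
    then have ab: "?a > 0" "?b > 0" by auto
    have pw: "?a powr p = p_integral p f" "?b powr p = p_integral p g"
      using assms pos by (simp_all add: powr_powr)
    have "p_integral p (f + g) \<le> (?a + ?b) powr p * (?a / (?a + ?b) + ?b / (?a + ?b))"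
      using p_integral_add_convex[OF True assms(2,3) ab] pos unfolding pw by simp
    also have "\<dots> = (?a + ?b) powr p"
      using ab by (simp add: add_divide_distrib[symmetric])
    finally have "p_integral p (f + g) powr (1 / p) \<le> ((?a + ?b) powr p) powr (1 / p)"
      using assms p_integral_nonneg by (intro powr_mono2) auto
    also have "\<dots> = ?a + ?b"
      using assms ab by (simp add: powr_powr)
    finally show ?thesis
      using True by (simp add: Lp_norm_def)
  qed (auto simp: Lp_norm_def p_integral_nonneg)
qed

lemma Metric_space_Lp:
  assumes "0 < p"
  shows "Metric_space (Lp p) (Lp_dist p)"
proof
  have sub: "in_Lp p (f - g)" if "f \<in> Lp p" "g \<in> Lp p" for f g :: "'a L0"
  proof -
    interpret vector_space "scale_L0 :: 'a \<Rightarrow> _" by (rule vector_space_scale_L0)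
    show ?thesis
      using subspace_diff[OF subspace_Lp[OF assms] that] by (simp add: Lp_def)
  qed
  fix f g h :: "'a L0"
  show "0 \<le> Lp_dist p f g"
    by (simp add: Lp_dist_def Lp_norm_def p_integral_nonneg)
  show "Lp_dist p f g = Lp_dist p g f"
    using p_integral_minus[of p "f - g"] by (simp add: Lp_dist_def Lp_norm_def)
  show "Lp_dist p f g = 0 \<longleftrightarrow> f = g" if "f \<in> Lp p" "g \<in> Lp p"
    using sub[OF that] assms by (simp add: Lp_dist_def Lp_norm_def p_integral_eq_0_iff)
  show "Lp_dist p f h \<le> Lp_dist p f g + Lp_dist p g h"
    if "f \<in> Lp p" "g \<in> Lp p" "h \<in> Lp p"
    using Lp_norm_add_le[OF assms sub sub, of f g g h] that by (simp add: Lp_dist_def)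
qed

lemma topspace_Lp_topology: "0 < p \<Longrightarrow> topspace (Lp_topology p) = Lp p"
  unfolding Lp_topology_def by (rule Metric_space.topspace_mtopology[OF Metric_space_Lp])

end

theory Submission
  imports Defs "HOL-Real_Asymp.Real_Asymp"
begin

text \<open>
  Let \<open>Y\<close> be the union of the spaces \<open>L\<^sub>q\<close> with \<open>q > p\<close>. As the measure is finite, these spaces decrease
  in \<open>q\<close>, so \<open>Y\<close> is a linear subspace of \<open>L\<^sub>p\<close>, and truncation shows that it is dense. For \<open>f\<close> outside
  \<open>Y\<close> the task is to find a dense subspace \<open>W\<close> of full dimension that contains \<open>f\<close> and meets \<open>Y\<close> only
  in \<open>0\<close>.

  The analytic input is an operator \<open>T\<close> that turns every nonzero function into one that is as bad as
  possible. It puts a squeezed copy of \<open>g\<close> on each dyadic interval \<open>(2\<^sup>-\<^sup>n\<^sup>-\<^sup>1, 2\<^sup>-\<^sup>n]\<close>, multiplied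
  by \<open>w\<^sub>n = (2\<^sup>n / (n + 1)\<^sup>2)\<^bsup>1/p\<^esup>\<close>. Then the integral of \<open>|T g|\<^sup>q\<close> is the integral of \<open>|g|\<^sup>q\<close> times
  the sum of the \<open>w\<^sub>n\<^sup>q / 2\<^sup>n\<^sup>+\<^sup>1\<close> (\<open>nn_integral_copies\<close>), and this sum is finite for \<open>q = p\<close> and
  infinite for \<open>q > p\<close>. So \<open>T\<close> maps \<open>L\<^sub>p\<close> linearly into itself, and \<open>T g \<in> Y\<close> only for \<open>g = 0\<close>.

  The rest is linear algebra (\<open>exists_approximating_complement\<close>). Let \<open>D\<close> be a Hamel basis of \<open>Y\<close>. The
  iterates \<open>T\<^sup>n d\<close> with \<open>n \<ge> 1\<close> and \<open>d \<in> D\<close> are independent modulo \<open>Y\<close>. This gives a complement \<open>Z\<close>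
  of \<open>Y\<close> with a basis that contains \<open>f\<close> and these iterates, except possibly one; the shift \<open>T\<close> shows
  that \<open>Z\<close> has the dimension of \<open>L\<^sub>p\<close>. Tilting \<open>Z\<close> by a linear map from \<open>Z\<close> to \<open>Y\<close> yields another
  complement \<open>W\<close>. The map may be chosen to vanish at \<open>f\<close>, so that \<open>f \<in> W\<close>, and to make \<open>W\<close> contain,
  for each \<open>d\<close>, the vectors \<open>d + s T\<^sup>n d\<close> for almost all \<open>n\<close>, with prescribed nonzero scalars \<open>s\<close>
  that may depend on \<open>n\<close> and \<open>d\<close>.
  For small \<open>s\<close> these vectors tend to \<open>d\<close>. Hence the closure of \<open>W\<close> contains \<open>Y\<close> and so is \<open>L\<^sub>p\<close>.

  The argument is the same for all scalar fields that the definitions admit, so the real and the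
  complex case are instances of \<open>pointwise_maximal_dense_lineable_Lp\<close>.
\<close>


section \<open>Complements that approximate a given subspace\<close>

context vector_space
begin

lemma independent_UnI:
  assumes A: "independent A" and B: "independent B" and AB: "span A \<inter> span B \<subseteq> {0}"
  shows "independent (A \<union> B)"
proof -
  have *: "a \<notin> span (P \<union> Q - {a})"
    if P: "independent P" and PQ: "span P \<inter> span Q \<subseteq> {0}" and a: "a \<in> P" for a P Q
  proof
    assume "a \<in> span (P \<union> Q - {a})"
    then have "a \<in> span ((P - {a}) \<union> Q)"
      using span_mono[of "P \<union> Q - {a}" "(P - {a}) \<union> Q"] by blast
    then obtain x y where xy: "a = x + y" "x \<in> span (P - {a})" "y \<in> span Q"
      by (auto simp: span_Un)
    have "x \<in> span P"
      using xy(2) span_mono[of "P - {a}" P] by blast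
    then have "y \<in> span P"
      using span_diff[OF span_base[OF a], of x] xy(1) by simp
    then have "y = 0" using PQ xy(3) by blast
    then show False
      using P a xy by (auto simp: dependent_def)
  qed
  show ?thesis
    using *[OF A AB] *[OF B, of A] AB by (auto simp: dependent_def Int_commute Un_commute)
qed

lemma span_Int_span_if_independent_Un:
  assumes "independent (A \<union> B)" "A \<inter> B = {}"
  shows "span A \<inter> span B \<subseteq> {0}"
proof
  fix v assume v: "v \<in> span A \<inter> span B"
  have iA: "independent A" using assms(1) by (rule independent_mono) simp
  have "representation A v = representation B v"
    using representation_extend[OF assms(1), of v A] representation_extend[OF assms(1), of v B] v
    by simp
  then have "representation A v b = 0" for b
    using representation_ne_zero[of A v b] representation_ne_zero[of B v b] assms(2) by auto
  then show "v \<in> {0}"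
    using sum_nonzero_representation_eq[OF iA, of v] v by simp
qed

text \<open>
  Exchange steered away from \<open>D\<close>: the expansion of \<open>f\<close> has a nonzero coefficient outside \<open>D\<close>, so the
  basis vector removed in favour of \<open>f\<close> can be taken there and \<open>D\<close> survives.
\<close>

lemma exchange_outside:
  assumes ind: "independent (D \<union> C)" and f: "f \<in> span (D \<union> C)" "f \<notin> span D"
  obtains t where "t \<in> C" "t \<notin> D" "independent (insert f (D \<union> C - {t}))"
    "span (insert f (D \<union> C - {t})) = span (D \<union> C)" "f \<notin> span (D \<union> C - {t})"
proof -
  let ?B = "D \<union> C"
  obtain t where t: "representation ?B f t \<noteq> 0" "t \<notin> D"
  proof (rule ccontr)
    assume "\<not> thesis"
    then have "{b. representation ?B f b \<noteq> 0} \<subseteq> D" using that by blast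
    then have "(\<Sum>b | representation ?B f b \<noteq> 0. scale (representation ?B f b) b) \<in> span D"
      by (intro span_sum span_scale span_base) auto
    then show False
      using sum_nonzero_representation_eq[OF ind f(1)] f(2) by simp
  qed
  have tB: "t \<in> ?B" using t(1) representation_ne_zero by blast
  have nf: "f \<notin> span (?B - {t})"
  proof
    assume "f \<in> span (?B - {t})"
    then have "representation ?B f = representation (?B - {t}) f"
      using ind by (intro representation_extend) auto
    then show False
      using t(1) representation_ne_zero[of "?B - {t}" f t] by auto
  qed
  have "t \<in> span (insert f (?B - {t}))"
    using in_span_insert[OF _ nf, of t] f(1) tB by (simp add: insert_absorb)
  then have "?B \<subseteq> span (insert f (?B - {t}))"
    by (auto intro: span_base)
  then have "span ?B \<subseteq> span (insert f (?B - {t}))"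
    by (intro span_minimal) auto
  moreover have "span (insert f (?B - {t})) \<subseteq> span ?B"
    using f(1) by (intro span_minimal) (auto intro: span_base)
  moreover have "independent (insert f (?B - {t}))"
    using nf independent_mono[OF ind] by (intro independent_insertI) auto
  ultimately show ?thesis
    using that[of t] t tB nf by blast
qed

text \<open>
  Since \<open>T\<close> is injective modulo \<open>Y\<close>, the sum \<open>Y + T Y + T\<^sup>2 Y + \<dots>\<close> is direct, so a basis \<open>D\<close> of \<open>Y\<close>
  extends to a basis \<open>D \<union> C0\<close> of \<open>V\<close> with all \<open>T\<^sup>n d\<close>, \<open>n \<ge> 1\<close>, in \<open>C0\<close>. One exchange
  puts \<open>f\<close> into \<open>C0\<close>, possibly at the cost of one \<open>T\<^sup>n d\<close>, and gives \<open>C\<close>. Then \<open>W\<close> is the graph \<open>{x + L x | x \<in> span C}\<close> of a linear map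
  \<open>L\<close> from the complement \<open>span C\<close> to \<open>Y\<close>. Every such graph is again a complement of \<open>Y\<close> and has the
  dimension of \<open>span C\<close>. The values of \<open>L\<close> on \<open>C\<close> are free: \<open>L f = 0\<close> puts \<open>f\<close> into \<open>W\<close>, and
  \<open>L (T\<^sup>n d) = d / s\<close> puts \<open>d + s T\<^sup>n d\<close> into \<open>W\<close>. In a topological vector space
  scalars \<open>s\<close> that decrease fast enough with \<open>n\<close> put \<open>d\<close> into the closure of \<open>W\<close>.

  The equality of the dimensions of \<open>span C\<close> and \<open>V\<close> needs no cardinal arithmetic: \<open>T\<close> shifts the
  orbit of \<open>D\<close> onto the orbit without \<open>D\<close>, as in Hilbert's hotel, and so maps \<open>D \<union> C0\<close> bijectively
  onto \<open>C0\<close>.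
\<close>

lemma exists_approximating_complement:
  assumes T: "Vector_Spaces.linear scale scale T"
    and V: "subspace V" and Y: "Y \<subseteq> V"
    and TV: "T ` V \<subseteq> V"
    and TY: "\<And>x. x \<in> V \<Longrightarrow> T x \<in> Y \<Longrightarrow> x = 0"
    and f: "f \<in> V" "f \<notin> Y"
    and D: "independent D" "span D = Y"
    and s: "\<And>n d. s n d \<noteq> 0"
  obtains W where "subspace W" "W \<subseteq> V" "W \<inter> Y \<subseteq> {0}" "f \<in> W"
    "same_hamel_dim scale W V"
    "\<And>d. d \<in> D \<Longrightarrow> \<exists>N. \<forall>n\<ge>N. d + scale (s n d) ((T ^^ Suc n) d) \<in> W"
proof -
  interpret T: Vector_Spaces.linear scale scale T by fact
  have zeroY: "0 \<in> Y" using span_zero[of D] D(2) by simp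
  have scaleY: "scale a d \<in> Y" if "d \<in> D" for a d
    using span_scale[OF span_base[OF that]] D(2) by simp
  have injT: "inj_on T V"
    unfolding T.inj_on_iff_eq_0[OF V] using TY zeroY by simp
  have DV: "D \<subseteq> V" using D(2) Y span_superset by blast
  have spanV: "span X \<subseteq> V" if "X \<subseteq> V" for X
    using span_minimal[OF that V] .
  \<comment> \<open>The orbit of \<open>D\<close> is built as an increasing union, since independence passes from \<open>X\<close> to
    \<open>D \<union> T ` X\<close>.\<close>
  define U where "U = rec_nat {} (\<lambda>_ X. D \<union> T ` X)"
  have U0: "U 0 = {}" and US: "U (Suc n) = D \<union> T ` U n" for n
    by (simp_all add: U_def)
  have UV: "U n \<subseteq> V" for n
    using DV TV by (induction n) (auto simp: U0 US)
  have Umono: "U n \<subseteq> U (Suc n)" for n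
  proof (induction n)
    case (Suc n)
    then have "T ` U n \<subseteq> T ` U (Suc n)" by (rule image_mono)
    then show ?case unfolding US[of n] US[of "Suc n"] by blast
  qed (simp add: U0)
  have Uind: "independent (U n)" for n
  proof (induction n)
    case 0 show ?case by (simp add: U0 independent_empty)
  next
    case (Suc n)
    have sub: "span (U n) \<subseteq> V" by (rule spanV[OF UV])
    have "independent (T ` U n)"
      using inj_on_subset[OF injT sub] by (rule T.independent_injective_image[OF Suc])
    moreover have "span D \<inter> span (T ` U n) \<subseteq> {0}"
      unfolding T.span_image D(2) using TY sub T.zero by fastforce
    ultimately show ?case
      unfolding US using D(1) by (intro independent_UnI)
  qed
  define orbit where "orbit = (\<Union>n. U n)"
  have orbit_eq: "orbit = D \<union> T ` orbit"
  proof -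
    have "orbit = (\<Union>n. U (Suc n))"
      unfolding orbit_def using Umono by blast
    then show ?thesis by (auto simp: US orbit_def)
  qed
  have OV: "orbit \<subseteq> V" using UV by (auto simp: orbit_def)
  have Oind: "independent orbit"
    unfolding orbit_def
  proof (rule independent_Union_directed)
    fix c d assume "c \<in> range U" "d \<in> range U"
    then show "c \<subseteq> d \<or> d \<subseteq> c"
      using lift_Suc_mono_le[of U, OF Umono] by (metis imageE nat_le_linear)
  qed (use Uind in auto)
  have DT: "D \<inter> T ` orbit = {}"
  proof -
    have "d = 0" if "d \<in> D" "d = T u" "u \<in> orbit" for d u
    proof -
      have "T u \<in> Y" using that D(2) span_base by blast
      then show ?thesis using TY[of u] that OV T.zero by auto
    qed
    moreover have "0 \<notin> D" using D(1) dependent_zero by blast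
    ultimately show ?thesis unfolding disjoint_iff by (metis imageE)
  qed
  have TnO: "(T ^^ n) d \<in> orbit" if "d \<in> D" for d n
    using that by (induction n) (use orbit_eq in auto)
  obtain B where B: "orbit \<subseteq> B" "B \<subseteq> V" "independent B" "V \<subseteq> span B"
    by (rule maximal_independent_subset_extend[OF OV Oind])
  have spanB: "span B = V" using B(4) spanV[OF B(2)] by blast
  define C0 where "C0 = B - D"
  have DC0: "D \<union> C0 = B" using B(1) orbit_eq by (auto simp: C0_def)
  have TO: "T ` orbit \<subseteq> C0" using B(1) orbit_eq DT by (auto simp: C0_def)
  obtain t where t: "t \<in> C0" "t \<notin> D" "independent (insert f (B - {t}))"
    "span (insert f (B - {t})) = V" "f \<notin> span (B - {t})"
    using exchange_outside[of D C0 f] f B(3) unfolding DC0 spanB D(2) by blast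
  define C where "C = insert f (C0 - {t})"
  have fD: "f \<notin> D" using f D(2) span_base by blast
  have DC: "insert f (B - {t}) = D \<union> C" using t DC0 by (auto simp: C_def)
  have indDC: "independent (D \<union> C)" and spanDC: "span (D \<union> C) = V"
    using t unfolding DC by auto
  have disj: "D \<inter> C = {}" using fD by (auto simp: C_def C0_def)
  have indC: "independent C" using indDC by (rule independent_mono) simp
  have spC: "span D \<inter> span C \<subseteq> {0}"
    by (rule span_Int_span_if_independent_Un[OF indDC disj])
  have fC0: "f \<notin> C0 - {t}"
    using t(5) span_base[of f "B - {t}"] by (auto simp: C0_def)
  \<comment> \<open>\<open>?h\<close> is the shift along the orbit, \<open>?g\<close> carries out the exchange.\<close>
  have BC: "B \<approx> C"
  proof -
    let ?h = "\<lambda>x. if x \<in> orbit then T x else x"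
    let ?g = "\<lambda>x. if x = t then f else x"
    have 1: "bij_betw ?h B C0"
    proof (rule bij_betwI')
      fix x y assume xy: "x \<in> B" "y \<in> B"
      have "T u \<in> orbit" if "u \<in> orbit" for u using orbit_eq that by blast
      then show "?h x = ?h y \<longleftrightarrow> x = y"
        using injT OV by (auto simp: inj_on_def)
    next
      fix x assume "x \<in> B"
      then show "?h x \<in> C0" using TO orbit_eq by (auto simp: C0_def)
    next
      fix y assume y: "y \<in> C0"
      show "\<exists>x\<in>B. y = ?h x"
      proof (cases "y \<in> orbit")
        case True
        then have "y \<in> T ` orbit" using y orbit_eq by (auto simp: C0_def)
        then show ?thesis using B(1) by auto
      next
        case False
        then show ?thesis using y by (auto simp: C0_def)
      qed
    qed
    have 2: "bij_betw ?g C0 C"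
      using fC0 t(1) by (auto simp: bij_betw_def inj_on_def C_def)
    from bij_betw_trans[OF 1 2] show ?thesis by (auto simp: eqpoll_def)
  qed
  \<comment> \<open>A point of the orbit determines its exponent and its starting point, so that \<open>L\<close> may be
    prescribed on the orbit through them.\<close>
  have uniq: "n = m \<and> d = e" if "d \<in> D" "e \<in> D" "(T ^^ n) d = (T ^^ m) e" for n m d e
    using that
  proof (induction n arbitrary: m)
    case 0
    then show ?case using DT TnO[OF 0(2)] by (cases m) auto
  next
    case (Suc n)
    show ?case
    proof (cases m)
      case 0
      then show ?thesis using Suc.prems DT TnO[OF Suc.prems(1)] by auto
    next
      case (Suc k)
      then have "(T ^^ n) d = (T ^^ k) e"
        using Suc.prems injT TnO[OF Suc.prems(1)] TnO[OF Suc.prems(2)] OV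
        by (auto dest: inj_onD)
      then show ?thesis using Suc.IH[of k] Suc.prems Suc by simp
    qed
  qed
  define z where "z = (\<lambda>(n, d). (T ^^ Suc n) d)"
  have inj_z: "inj_on z (UNIV \<times> D)"
  proof (rule inj_onI)
    fix x y assume "x \<in> UNIV \<times> D" "y \<in> UNIV \<times> D" and eq: "z x = z y"
    then obtain n d m e where xy: "x = (n, d)" "y = (m, e)" "d \<in> D" "e \<in> D" by blast
    then show "x = y"
      using uniq[of d e "Suc n" "Suc m"] eq by (simp add: z_def)
  qed
  define l where "l c = (if c \<in> D \<or> c = f \<or> c \<notin> z ` (UNIV \<times> D) then 0
    else case inv_into (UNIV \<times> D) z c of (n, d) \<Rightarrow> scale (inverse (s n d)) d)" for c
  have l_iter: "l ((T ^^ Suc n) d) = scale (inverse (s n d)) d"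
    if d: "d \<in> D" and n: "(T ^^ Suc n) d \<noteq> t" for n d
  proof -
    have zz: "(T ^^ Suc n) d = z (n, d)" by (simp add: z_def)
    have "(T ^^ Suc n) d \<in> C0 - {t}" using TO TnO[OF d, of n] n by auto
    then have "z (n, d) \<notin> D" "z (n, d) \<noteq> f" using fC0 zz by (auto simp: C0_def)
    moreover have "inv_into (UNIV \<times> D) z (z (n, d)) = (n, d)"
      using d by (intro inv_into_f_f[OF inj_z]) simp
    moreover have "z (n, d) \<in> z ` (UNIV \<times> D)" using d by blast
    ultimately show ?thesis unfolding zz l_def by simp
  qed
  have lY: "l c \<in> Y" for c
  proof (cases "c \<in> z ` (UNIV \<times> D)")
    case True
    then have "inv_into (UNIV \<times> D) z c \<in> UNIV \<times> D" by (rule inv_into_into)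
    then show ?thesis using zeroY scaleY by (auto simp: l_def)
  qed (simp add: l_def zeroY)
  interpret pair: vector_space_pair scale scale by unfold_locales
  obtain L where L: "Vector_Spaces.linear scale scale L" and Lb: "\<And>b. b \<in> D \<union> C \<Longrightarrow> L b = l b"
    using pair.linear_independent_extend[OF indDC, of l] by blast
  interpret L: Vector_Spaces.linear scale scale L by fact
  have LY: "L x \<in> Y" if "x \<in> V" for x
  proof -
    have "L ` span (D \<union> C) \<subseteq> span D"
      unfolding L.span_image[symmetric]
      using Lb lY D(2) by (intro span_minimal) auto
    then show ?thesis using that spanDC D(2) by blast
  qed
  define M where "M x = x + L x" for x
  interpret M: Vector_Spaces.linear scale scale M
    by unfold_locales (auto simp: M_def L.add L.scale scale_right_distrib algebra_simps)
  have CV: "span C \<subseteq> V" using spanDC span_mono[of C "D \<union> C"] by blast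
  have MY: "x = 0" if "x \<in> span C" "M x \<in> Y" for x
  proof -
    have "L x \<in> Y" using LY that CV by blast
    then have "M x - L x \<in> span D"
      using that(2) D(2) by (intro span_diff) auto
    then have "x \<in> span D" by (simp add: M_def)
    then show ?thesis using spC that(1) by blast
  qed
  have injM: "inj_on M (span C)"
    unfolding M.inj_on_iff_eq_0[OF subspace_span] using MY zeroY by simp
  define W where "W = span (M ` C)"
  have W: "W = M ` span C" by (simp add: W_def M.span_image)
  have "C \<approx> M ` C"
    using inj_on_subset[OF injM span_superset] by (rule inj_on_image_eqpoll_self[THEN eqpoll_sym])
  then have "M ` C \<approx> B" using BC eqpoll_sym eqpoll_trans by blast
  moreover have "independent (M ` C)"
    by (rule M.independent_injective_image[OF indC injM])
  ultimately have dim: "same_hamel_dim scale W V"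
    unfolding same_hamel_dim_def using B(3) spanB W_def by blast
  show ?thesis
  proof (rule that[of W])
    show "subspace W" by (simp add: W_def)
    show "W \<subseteq> V"
    proof
      fix w assume "w \<in> W"
      then obtain x where "w = x + L x" "x \<in> V" using CV by (auto simp: W M_def)
      then show "w \<in> V" using LY Y subspace_add[OF V] by blast
    qed
    show "W \<inter> Y \<subseteq> {0}"
    proof
      fix w assume "w \<in> W \<inter> Y"
      then obtain x where "w = M x" "x \<in> span C" "M x \<in> Y" by (auto simp: W)
      then show "w \<in> {0}" using MY[of x] M.zero by simp
    qed
    show "f \<in> W"
    proof -
      have "M f = f" using Lb[of f] by (simp add: M_def C_def l_def)
      moreover have "f \<in> span C" by (simp add: C_def span_base)
      ultimately show ?thesis unfolding W by (metis imageI)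
    qed
    show "same_hamel_dim scale W V" by fact
    fix d assume d: "d \<in> D"
    \<comment> \<open>The exchange may have removed one point \<open>t\<close> of the orbit; the powers beyond it remain.\<close>
    have "\<exists>N. \<forall>n\<ge>N. (T ^^ Suc n) d \<noteq> t"
    proof (cases "\<exists>n. (T ^^ Suc n) d = t")
      case True
      then obtain n where n: "(T ^^ Suc n) d = t" by blast
      have "(T ^^ Suc m) d \<noteq> t" if "m \<ge> Suc n" for m
        using uniq[OF d d, of "Suc m" "Suc n"] n that by auto
      then show ?thesis by blast
    qed blast
    then obtain N where N: "(T ^^ Suc n) d \<noteq> t" if "n \<ge> N" for n by blast
    have "d + scale (s n d) ((T ^^ Suc n) d) \<in> W" if "n \<ge> N" for n
    proof -
      let ?c = "(T ^^ Suc n) d"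
      have c: "?c \<in> C" using TO TnO[OF d, of n] N[OF that] by (auto simp: C_def)
      then have "M ?c = ?c + scale (inverse (s n d)) d"
        using Lb[of ?c] l_iter[OF d N[OF that]] by (simp add: M_def)
      then have "scale (s n d) (M ?c) = d + scale (s n d) ?c"
        using s[of n d] by (simp add: scale_right_distrib)
      moreover have "scale (s n d) (M ?c) \<in> W"
        unfolding W_def using c by (intro span_scale span_base) auto
      ultimately show ?thesis by simp
    qed
    then show "\<exists>N. \<forall>n\<ge>N. d + scale (s n d) ((T ^^ Suc n) d) \<in> W" by blast
  qed
qed

end


section \<open>Weighted copies on the dyadic intervals\<close>

text \<open>
  The dyadic interval \<open>(2\<^sup>-\<^sup>n\<^sup>-\<^sup>1, 2\<^sup>-\<^sup>n]\<close> that contains \<open>x \<in> (0, 1]\<close> has number \<open>scale_index x\<close>.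
\<close>

definition scale_index :: "real \<Rightarrow> nat" where
  "scale_index x = nat \<lfloor>- log 2 x\<rfloor>"

text \<open>
  The factor \<open>2\<^sup>n\<close> compensates at exponent \<open>p\<close> exactly the length of the \<open>n\<close>-th dyadic interval. What
  remains is \<open>1 / (n + 1)\<^sup>2\<close> up to a constant, which is summable but gives way to the positive power
  of \<open>2\<^sup>n\<close> left over at any larger exponent.
\<close>

definition weight :: "real \<Rightarrow> nat \<Rightarrow> real" where
  "weight p n = (2 ^ n / (real n + 1)\<^sup>2) powr (1 / p)"

text \<open>
  The function \<open>g\<close> on \<open>(0, 1]\<close>, squeezed into the \<open>n\<close>-th dyadic interval and extended by \<open>0\<close>.
\<close>

definition window :: "(real \<Rightarrow> 'k) \<Rightarrow> nat \<Rightarrow> real \<Rightarrow> 'k::real_normed_vector" where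
  "window g n x = indicator {0<..1} (- 1 + 2 ^ Suc n * x) *\<^sub>R g (- 1 + 2 ^ Suc n * x)"

definition copies :: "real \<Rightarrow> (real \<Rightarrow> 'k) \<Rightarrow> real \<Rightarrow> 'k::real_normed_vector" where
  "copies p g x = weight p (scale_index x) *\<^sub>R window g (scale_index x) x"

lemma window_nonzero_scale_index:
  assumes "window g n x \<noteq> 0"
  shows "x \<in> {0<..1}" "scale_index x = n"
proof -
  have b: "1 < 2 ^ Suc n * x" "2 ^ Suc n * x \<le> 2"
    using assms by (auto simp: window_def indicator_def split: if_splits)
  then have pos: "x > 0"
    by (metis less_trans zero_less_one zero_less_mult_pos zero_less_numeral zero_less_power)
  moreover have "x \<le> 1"
  proof -
    have "2 * x \<le> 2 ^ Suc n * x" using pos by (intro mult_right_mono) auto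
    then show ?thesis using b by linarith
  qed
  ultimately show "x \<in> {0<..1}" by simp
  have l: "log 2 (2 ^ Suc n * x) = real (Suc n) + log 2 x"
    using pos by (simp add: log_mult log_nat_power)
  have "0 < log 2 (2 ^ Suc n * x)" "log 2 (2 ^ Suc n * x) \<le> 1"
    using b pos by auto
  then have "\<lfloor>- log 2 x\<rfloor> = int n"
    unfolding l by (intro floor_unique) auto
  then show "scale_index x = n" by (simp add: scale_index_def)
qed

lemma nn_integral_unit_lebesgue:
  fixes g :: "real \<Rightarrow> ennreal"
  shows "(\<integral>\<^sup>+x. g x \<partial>unit_lebesgue) = (\<integral>\<^sup>+x. g x * indicator {0<..1} x \<partial>lebesgue)"
proof -
  have "(\<integral>\<^sup>+x. g x \<partial>unit_lebesgue) = (\<integral>\<^sup>+x. g x * indicator {0..1} x \<partial>lebesgue)"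
    by (rule nn_integral_restrict_space) simp
  also have "\<dots> = (\<integral>\<^sup>+x. g x * indicator {0<..1} x \<partial>lebesgue)"
  proof (rule nn_integral_cong_AE)
    have "AE x in lebesgue. x \<noteq> (0::real)"
      by (rule AE_completion) (rule AE_lborel_singleton)
    then show "AE x in lebesgue. g x * indicator {0..1} x = g x * indicator {0<..1} x"
      by (auto simp: indicator_def elim!: AE_mp)
  qed
  finally show ?thesis .
qed

lemma measurable_zero_extension:
  fixes g :: "real \<Rightarrow> 'k::{real_normed_vector, second_countable_topology}"
  assumes "g \<in> borel_measurable unit_lebesgue"
  shows "(\<lambda>x. indicator {0<..1} x *\<^sub>R g x) \<in> borel_measurable lebesgue"
proof -
  have "(\<lambda>x. indicator {0..1} x *\<^sub>R g x) \<in> borel_measurable lebesgue"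
    using assms by (subst (asm) borel_measurable_restrict_space_iff) auto
  then have "(\<lambda>x. indicator {0<..1} x *\<^sub>R (indicator {0..1} x *\<^sub>R g x)) \<in> borel_measurable lebesgue"
    by (rule borel_measurable_scaleR[OF borel_measurable_indicator, rotated]) simp
  also have "(\<lambda>x. indicator {0<..1} x *\<^sub>R (indicator {0..1} x *\<^sub>R g x)) = (\<lambda>x. indicator {0<..1} x *\<^sub>R g x)"
    by (auto simp: fun_eq_iff indicator_def)
  finally show ?thesis .
qed

lemma measurable_window:
  fixes g :: "real \<Rightarrow> 'k::{real_normed_vector, second_countable_topology}"
  assumes "g \<in> borel_measurable unit_lebesgue"
  shows "window g n \<in> borel_measurable lebesgue"
proof -
  have "(\<lambda>x. - 1 + 2 ^ Suc n * x :: real) \<in> lebesgue \<rightarrow>\<^sub>M lebesgue"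
    using lebesgue_affine_measurable[where c= "\<lambda>x::real. 2 ^ Suc n" and t = "- 1"] by simp
  from measurable_compose[OF this measurable_zero_extension[OF assms]]
  show ?thesis by (simp add: window_def[abs_def])
qed

lemma measurable_scale_index: "scale_index \<in> measurable lebesgue (count_space UNIV)"
proof -
  have "(\<lambda>x. - log 2 x) \<in> borel_measurable lebesgue"
    by (intro measurable_completion) measurable
  then show ?thesis unfolding scale_index_def[abs_def] by measurable
qed

lemma measurable_copies_lebesgue:
  fixes g :: "real \<Rightarrow> 'k::{real_normed_vector, second_countable_topology}"
  assumes "g \<in> borel_measurable unit_lebesgue"
  shows "copies p g \<in> borel_measurable lebesgue"
proof -
  have "(\<lambda>x. weight p n *\<^sub>R window g n x) \<in> borel_measurable lebesgue" for n
    using measurable_window[OF assms] by (intro borel_measurable_scaleR) auto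
  from measurable_compose_countable[OF this measurable_scale_index]
  show ?thesis by (simp add: copies_def[abs_def])
qed

lemma measurable_copies:
  fixes g :: "real \<Rightarrow> 'k::{real_normed_vector, second_countable_topology}"
  assumes "g \<in> borel_measurable unit_lebesgue"
  shows "copies p g \<in> borel_measurable unit_lebesgue"
  using measurable_copies_lebesgue[OF assms] by (rule measurable_restrict_space1)

text \<open>
  At each point at most one window is nonzero, so powers may be taken termwise. The identity holds on
  the whole line, because all windows vanish outside \<open>(0, 1]\<close>; this allows integrating each summand
  over the line, where affine substitution is available.
\<close>

lemma norm_copies_powr:
  fixes g :: "real \<Rightarrow> 'k::real_normed_vector"
  shows "ennreal (norm (copies p g x) powr q) * indicator {0<..1} x
    = (\<Sum>n. ennreal (weight p n powr q) * ennreal (norm (window g n x) powr q))"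
proof -
  let ?t = "\<lambda>n. ennreal (weight p n powr q) * ennreal (norm (window g n x) powr q)"
  have w: "weight p n \<ge> 0" for n by (simp add: weight_def)
  have "(\<Sum>n. ?t n) = (\<Sum>n\<in>{scale_index x}. ?t n)"
  proof (rule suminf_finite)
    fix n assume "n \<notin> {scale_index x}"
    then have "window g n x = 0" using window_nonzero_scale_index(2)[of g n x] by auto
    then show "?t n = 0" by simp
  qed simp
  also have "\<dots> = ennreal (norm (copies p g x) powr q)"
    using w by (simp add: copies_def powr_mult ennreal_mult')
  also have "\<dots> = ennreal (norm (copies p g x) powr q) * indicator {0<..1} x"
    using window_nonzero_scale_index(1)[of g "scale_index x" x]
    by (auto simp: indicator_def copies_def)
  finally show ?thesis ..
qed

text \<open>
  Squeezing by the affine map \<open>x \<mapsto> 2\<^sup>n\<^sup>+\<^sup>1 x - 1\<close> divides integrals by its slope.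
\<close>

lemma nn_integral_window:
  fixes g :: "real \<Rightarrow> 'k::{real_normed_vector, second_countable_topology}"
  assumes g: "g \<in> borel_measurable unit_lebesgue"
  shows "(\<integral>\<^sup>+x. ennreal (norm (window g n x) powr q) \<partial>lebesgue)
    = ennreal (1 / 2 ^ Suc n) * (\<integral>\<^sup>+x. ennreal (norm (g x) powr q) \<partial>unit_lebesgue)"
proof -
  define G where "G y = ennreal (norm (indicator {0<..1} y *\<^sub>R g y) powr q)" for y
  have mG: "G \<in> borel_measurable lebesgue"
    unfolding G_def[abs_def] using measurable_zero_extension[OF g] by measurable
  have "ennreal (norm (g x) powr q) * indicator {0<..1} x = G x" for x
    by (auto simp: G_def indicator_def)
  then have E: "(\<integral>\<^sup>+x. ennreal (norm (g x) powr q) \<partial>unit_lebesgue) = (\<integral>\<^sup>+x. G x \<partial>lebesgue)"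
    unfolding nn_integral_unit_lebesgue by simp
  have "(\<integral>\<^sup>+x. G x \<partial>lebesgue)
      = ennreal \<bar>2 ^ Suc n\<bar> * (\<integral>\<^sup>+x. G (- 1 + 2 ^ Suc n * x) \<partial>lebesgue)"
    by (rule nn_integral_real_affine_lebesgue[OF mG]) simp
  then have "ennreal (1 / 2 ^ Suc n) * (\<integral>\<^sup>+x. G x \<partial>lebesgue)
      = (ennreal (1 / 2 ^ Suc n) * ennreal (2 ^ Suc n)) * (\<integral>\<^sup>+x. G (- 1 + 2 ^ Suc n * x) \<partial>lebesgue)"
    by (simp add: mult.assoc)
  also have "ennreal (1 / 2 ^ Suc n) * ennreal (2 ^ Suc n) = 1"
    by (subst ennreal_mult[symmetric]) auto
  finally have "ennreal (1 / 2 ^ Suc n) * (\<integral>\<^sup>+x. G x \<partial>lebesgue)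
      = (\<integral>\<^sup>+x. G (- 1 + 2 ^ Suc n * x) \<partial>lebesgue)"
    by simp
  moreover have "ennreal (norm (window g n x) powr q) = G (- 1 + 2 ^ Suc n * x)" for x
    by (simp only: G_def window_def)
  ultimately show ?thesis unfolding E by simp
qed

text \<open>
  The effect of copying on the \<open>q\<close>-integral is a factor that does not depend on the function. This one
  identity shows that copying respects almost everywhere equality, keeps \<open>L\<^sub>p\<close>, and moves
  every nonzero function out of \<open>L\<^sub>q\<close> for all \<open>q > p\<close>.
\<close>

lemma nn_integral_copies:
  fixes g :: "real \<Rightarrow> 'k::{real_normed_vector, second_countable_topology}"
  assumes g: "g \<in> borel_measurable unit_lebesgue"
  shows "(\<integral>\<^sup>+x. ennreal (norm (copies p g x) powr q) \<partial>unit_lebesgue)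
    = (\<Sum>n. ennreal (weight p n powr q / 2 ^ Suc n)) *
      (\<integral>\<^sup>+x. ennreal (norm (g x) powr q) \<partial>unit_lebesgue)"
proof -
  let ?E = "\<integral>\<^sup>+x. ennreal (norm (g x) powr q) \<partial>unit_lebesgue"
  have m: "(\<lambda>x. ennreal (norm (window g n x) powr q)) \<in> borel_measurable lebesgue" for n
    using measurable_window[OF g, of n] by measurable
  have "(\<integral>\<^sup>+x. ennreal (norm (copies p g x) powr q) \<partial>unit_lebesgue)
      = (\<integral>\<^sup>+x. (\<Sum>n. ennreal (weight p n powr q) * ennreal (norm (window g n x) powr q)) \<partial>lebesgue)"
    unfolding nn_integral_unit_lebesgue norm_copies_powr ..
  also have "\<dots> = (\<Sum>n. \<integral>\<^sup>+x. ennreal (weight p n powr q) * ennreal (norm (window g n x) powr q) \<partial>lebesgue)"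
    using m by (intro nn_integral_suminf) auto
  also have "\<dots> = (\<Sum>n. ennreal (weight p n powr q) * (ennreal (1 / 2 ^ Suc n) * ?E))"
    using m by (simp add: nn_integral_cmult nn_integral_window[OF g])
  also have "\<dots> = (\<Sum>n. ennreal (weight p n powr q / 2 ^ Suc n) * ?E)"
    by (simp add: mult.assoc[symmetric] ennreal_mult'[symmetric])
  finally show ?thesis by simp
qed

lemma weight_powr: "weight p n powr q = (2 ^ n / (real n + 1)\<^sup>2) powr (q / p)"
  by (simp add: weight_def powr_powr)

lemma suminf_weight_finite:
  assumes "p > 0"
  shows "(\<Sum>n. ennreal (weight p n powr p / 2 ^ Suc n)) < \<infinity>"
proof -
  have eq: "weight p n powr p / 2 ^ Suc n = 1 / 2 * (1 / (real (Suc n))\<^sup>2)" for n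
    using assms by (simp add: weight_powr add.commute)
  have "summable (\<lambda>n. 1 / (real (Suc n))\<^sup>2)"
    using sums_summable[OF inverse_squares_sums] by (simp add: add.commute)
  then have "summable (\<lambda>n. weight p n powr p / 2 ^ Suc n)"
    unfolding eq by (rule summable_mult)
  then show ?thesis
    by (subst suminf_ennreal2) (auto simp: weight_def)
qed

lemma suminf_weight_infinite:
  assumes "p > 0" "q > p"
  shows "(\<Sum>n. ennreal (weight p n powr q / 2 ^ Suc n)) = \<infinity>"
proof (rule ccontr)
  assume "\<not> ?thesis"
  then have "summable (\<lambda>n. weight p n powr q / 2 ^ Suc n)"
    by (intro summable_suminf_not_top) (auto simp: weight_def)
  then have lim: "(\<lambda>n. weight p n powr q / 2 ^ Suc n) \<longlonglongrightarrow> 0"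
    by (rule summable_LIMSEQ_zero)
  \<comment> \<open>The \<open>n\<close>-th term is \<open>2\<^sup>n\<^sup>e\<close> up to a power of \<open>n + 1\<close> and a constant.\<close>
  define e where "e = q / p - 1"
  have e: "e > 0" and qp: "q / p = 1 + e"
    using assms by (auto simp: e_def field_simps)
  have "filterlim (\<lambda>n. (2 ^ n / (real n + 1)\<^sup>2) powr (1 + e) / 2 ^ Suc n) at_top sequentially"
    using e by real_asymp
  then show False
    using lim unfolding weight_powr qp
    by (metis filterlim_at_top_imp_at_infinity not_tendsto_and_filterlim_at_infinity sequentially_bot)
qed


section \<open>The copying operator on classes of functions\<close>

lift_definition copies_L0 ::
  "real \<Rightarrow> 'k L0 \<Rightarrow> 'k::{real_normed_field, second_countable_topology} L0" is copies
proof -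
  fix p :: real and f g :: "real \<Rightarrow> 'k"
  assume fg: "ae_equal f g"
  then have m: "f \<in> borel_measurable unit_lebesgue" "g \<in> borel_measurable unit_lebesgue"
    and ae: "AE x in unit_lebesgue. f x = g x"
    by (auto simp: ae_equal_def)
  let ?d = "\<lambda>x. f x - g x"
  have md: "?d \<in> borel_measurable unit_lebesgue" using m by simp
  note mc = measurable_copies[OF md, of p]
  have "(\<integral>\<^sup>+x. ennreal (norm (?d x) powr 1) \<partial>unit_lebesgue) = 0"
    using ae md by (subst nn_integral_0_iff_AE) (auto elim!: AE_mp)
  then have "(\<integral>\<^sup>+x. ennreal (norm (copies p ?d x) powr 1) \<partial>unit_lebesgue) = 0"
    unfolding nn_integral_copies[OF md] by simp
  then have "AE x in unit_lebesgue. copies p ?d x = 0"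
    using mc by (subst (asm) nn_integral_0_iff_AE) auto
  moreover have "copies p ?d x = copies p f x - copies p g x" for x
    by (simp add: copies_def window_def scaleR_diff_right)
  ultimately show "ae_equal (copies p f) (copies p g)"
    using measurable_copies[OF m(1)] measurable_copies[OF m(2)] by (simp add: ae_equal_def)
qed

lemma linear_copies_L0: "Vector_Spaces.linear scale_L0 scale_L0 (copies_L0 p)"
proof -
  have mc: "copies p f \<in> borel_measurable unit_lebesgue" if "ae_equal f f" for f :: "real \<Rightarrow> 'a"
    using that by (auto simp: ae_equal_def intro: measurable_copies)
  have add: "copies_L0 p (f + g) = copies_L0 p f + copies_L0 p g" for f g :: "'a L0"
  proof (transfer fixing: p)
    fix f g :: "real \<Rightarrow> 'a" assume fg: "ae_equal f f" "ae_equal g g"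
    have "copies p (\<lambda>x. f x + g x) = (\<lambda>x. copies p f x + copies p g x)"
      by (simp add: fun_eq_iff copies_def window_def scaleR_add_right)
    then show "ae_equal (copies p (\<lambda>x. f x + g x)) (\<lambda>x. copies p f x + copies p g x)"
      using mc[OF fg(1)] mc[OF fg(2)] by (simp add: ae_equal_def)
  qed
  have scale: "copies_L0 p (scale_L0 c f) = scale_L0 c (copies_L0 p f)" for c and f :: "'a L0"
  proof (transfer fixing: p)
    fix c :: 'a and f :: "real \<Rightarrow> 'a" assume f: "ae_equal f f"
    have "copies p (\<lambda>x. c * f x) = (\<lambda>x. c * copies p f x)"
      by (simp add: fun_eq_iff copies_def window_def)
    then show "ae_equal (copies p (\<lambda>x. c * f x)) (\<lambda>x. c * copies p f x)"
      using mc[OF f] by (simp add: ae_equal_def)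
  qed
  show ?thesis
    unfolding Vector_Spaces.linear_iff using vector_space_scale_L0 add scale by blast
qed

lemma integrable_norm_powr_iff:
  fixes f :: "real \<Rightarrow> 'k::{real_normed_vector, second_countable_topology}"
  assumes "f \<in> borel_measurable unit_lebesgue"
  shows "integrable unit_lebesgue (\<lambda>x. norm (f x) powr q)
    \<longleftrightarrow> (\<integral>\<^sup>+x. ennreal (norm (f x) powr q) \<partial>unit_lebesgue) < \<infinity>"
  using assms by (simp add: integrable_iff_bounded)

lemma in_Lp_copies_L0:
  assumes "p > 0" "in_Lp p f"
  shows "in_Lp p (copies_L0 p f)"
  using assms(2)
proof (transfer fixing: p)
  fix f :: "real \<Rightarrow> 'a"
  assume "ae_equal f f" "integrable unit_lebesgue (\<lambda>x. norm (f x) powr p)"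
  then show "integrable unit_lebesgue (\<lambda>x. norm (copies p f x) powr p)"
    using suminf_weight_finite[OF \<open>p > 0\<close>]
    by (simp add: ae_equal_def integrable_norm_powr_iff measurable_copies nn_integral_copies
        ennreal_mult_less_top)
qed

lemma in_Lp_copies_L0_imp_eq_0:
  assumes "p > 0" "q > p" "in_Lp q (copies_L0 p f)"
  shows "f = 0"
  using assms(3)
proof (transfer fixing: p q)
  fix f :: "real \<Rightarrow> 'a"
  assume f: "ae_equal f f" and i: "integrable unit_lebesgue (\<lambda>x. norm (copies p f x) powr q)"
  have m: "f \<in> borel_measurable unit_lebesgue" using f by (simp add: ae_equal_def)
  have "\<infinity> * (\<integral>\<^sup>+x. ennreal (norm (f x) powr q) \<partial>unit_lebesgue) < \<infinity>"
    using i[unfolded integrable_norm_powr_iff[OF measurable_copies[OF m]]]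
    unfolding nn_integral_copies[OF m] suminf_weight_infinite[OF assms(1,2)] .
  then have "(\<integral>\<^sup>+x. ennreal (norm (f x) powr q) \<partial>unit_lebesgue) = 0"
    by (simp add: ennreal_mult_less_top)
  then have "AE x in unit_lebesgue. f x = 0"
    using m by (subst (asm) nn_integral_0_iff_AE) auto
  then show "ae_equal f (\<lambda>_. 0)" using m by (simp add: ae_equal_def)
qed

section \<open>Approximation in \<open>L\<^sub>p\<close> and the union of the \<open>L\<^sub>q\<close> with \<open>q > p\<close>\<close>

lemma in_Lp_antimono:
  assumes "0 < r" "r \<le> q" "in_Lp q f"
  shows "in_Lp r f"
  using assms(3)
proof (transfer fixing: r q)
  fix f :: "real \<Rightarrow> 'a"
  assume f: "ae_equal f f" and i: "integrable unit_lebesgue (\<lambda>x. norm (f x) powr q)"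
  have "integrable unit_lebesgue (\<lambda>x. 1 + norm (f x) powr q)"
    using i by (intro Bochner_Integration.integrable_add) auto
  then show "integrable unit_lebesgue (\<lambda>x. norm (f x) powr r)"
  proof (rule Bochner_Integration.integrable_bound)
    show "(\<lambda>x. norm (f x) powr r) \<in> borel_measurable unit_lebesgue"
      using f by (auto simp: ae_equal_def)
    have "norm (f x) powr r \<le> 1 + norm (f x) powr q" for x
    proof (cases "norm (f x) \<le> 1")
      case True
      then have "norm (f x) powr r \<le> 1" using assms(1) by (intro powr_le1) auto
      then show ?thesis by (simp add: add_increasing2)
    next
      case False
      then have "norm (f x) powr r \<le> norm (f x) powr q" using assms(2) by (intro powr_mono) auto
      then show ?thesis by simp
    qed
    then show "AE x in unit_lebesgue. norm (norm (f x) powr r) \<le> norm (1 + norm (f x) powr q)"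
      by (auto intro!: AE_I2 order_trans[OF _ abs_ge_self])
  qed
qed

lemma p_integral_truncation:
  assumes "p > 0" "q > 0" "in_Lp p f" "e > 0"
  shows "\<exists>g. in_Lp q g \<and> p_integral p (f - g) < e"
  using assms(3)
proof (transfer fixing: p q e)
  fix f :: "real \<Rightarrow> 'a"
  assume f: "ae_equal f f" and i: "integrable unit_lebesgue (\<lambda>x. norm (f x) powr p)"
  have m[measurable]: "f \<in> borel_measurable unit_lebesgue" using f by (simp add: ae_equal_def)
  define g where "g n x = (if norm (f x) \<le> real n then f x else 0)" for n x
  have mg[measurable]: "g n \<in> borel_measurable unit_lebesgue" for n
    unfolding g_def[abs_def] by measurable
  have "(\<lambda>n. LINT x|unit_lebesgue. norm (f x - g n x) powr p) \<longlonglongrightarrow> (LINT x|unit_lebesgue. 0)"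
  proof (rule integral_dominated_convergence[where w = "\<lambda>x. norm (f x) powr p"])
    show "AE x in unit_lebesgue. (\<lambda>n. norm (f x - g n x) powr p) \<longlonglongrightarrow> 0"
    proof (rule AE_I2)
      fix x
      obtain N where "norm (f x) \<le> real N" using real_arch_simple by blast
      then have "eventually (\<lambda>n. norm (f x - g n x) powr p = 0) sequentially"
        by (intro eventually_sequentiallyI[of N]) (auto simp: g_def)
      then show "(\<lambda>n. norm (f x - g n x) powr p) \<longlonglongrightarrow> 0" by (rule tendsto_eventually)
    qed
  qed (use i in \<open>auto simp: g_def\<close>)
  then have "eventually (\<lambda>n. (LINT x|unit_lebesgue. norm (f x - g n x) powr p) < e) sequentially"
    using \<open>e > 0\<close> by (intro order_tendstoD(2)) auto
  then obtain n where n: "(LINT x|unit_lebesgue. norm (f x - g n x) powr p) < e"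
    by (auto simp: eventually_sequentially)
  have "integrable unit_lebesgue (\<lambda>x. norm (g n x) powr q)"
  proof (rule Bochner_Integration.integrable_bound[where f = "\<lambda>_. real n powr q"])
    show "(\<lambda>x. norm (g n x) powr q) \<in> borel_measurable unit_lebesgue" by measurable
    show "AE x in unit_lebesgue. norm (norm (g n x) powr q) \<le> norm (real n powr q)"
      using \<open>q > 0\<close> by (intro AE_I2) (auto simp: g_def intro: powr_mono2)
  qed simp
  then show "\<exists>g\<in>{g. ae_equal g g}. integrable unit_lebesgue (\<lambda>x. norm (g x) powr q) \<and>
      (LINT x|unit_lebesgue. norm (f x - g x) powr p) < e"
    using n mg by (intro bexI[of _ "g n"]) (auto simp: ae_equal_def)
qed

lemma p_integral_scale: "p_integral p (scale_L0 c f) = norm c powr p * p_integral p f"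
  by transfer (simp add: norm_mult powr_mult)

text \<open>
  The degree of homogeneity of \<open>Lp_norm p\<close>, which is a norm for \<open>p \<ge> 1\<close> and a \<open>p\<close>-norm for \<open>0 < p < 1\<close>.
\<close>

definition homogeneity :: "real \<Rightarrow> real" where
  "homogeneity p = (if p \<ge> 1 then 1 else p)"

lemma Lp_norm_scale:
  assumes "p > 0"
  shows "Lp_norm p (scale_L0 c f) = norm c powr homogeneity p * Lp_norm p f"
  using assms
  by (simp add: Lp_norm_def homogeneity_def p_integral_scale powr_mult powr_powr p_integral_nonneg)

lemma Lp_norm_nonneg: "0 \<le> Lp_norm p f"
  by (simp add: Lp_norm_def p_integral_nonneg)

lemma exists_small_scale:
  fixes f :: "'k::{real_normed_field, second_countable_topology} L0"
  assumes "p > 0" "e > 0"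
  shows "\<exists>c. c \<noteq> 0 \<and> Lp_norm p (scale_L0 c f) < e"
proof -
  let ?h = "homogeneity p" and ?N = "Lp_norm p f"
  let ?c = "(e / (?N + 1)) powr (1 / ?h)"
  have h: "?h > 0" using assms by (simp add: homogeneity_def)
  have N: "?N + 1 > 0" using Lp_norm_nonneg[of p f] by simp
  have "Lp_norm p (scale_L0 (of_real ?c) f) = e / (?N + 1) * ?N"
    using h N assms by (simp add: Lp_norm_scale powr_powr)
  also have "\<dots> < e"
    using N assms by (simp add: field_simps)
  finally show ?thesis
    using N assms by (intro exI[of _ "of_real ?c"]) auto
qed

lemma subspace_Union_Lp:
  assumes "p > 0"
  shows "module.subspace scale_L0
    (\<Union>q\<in>{p<..}. Lp q :: 'k::{real_normed_field, second_countable_topology} L0 set)"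
    (is "module.subspace _ ?Y")
proof -
  interpret vector_space "scale_L0 :: 'k \<Rightarrow> _" by (rule vector_space_scale_L0)
  show ?thesis
  proof (rule subspaceI)
    show "0 \<in> ?Y" using assms gt_ex[of p] by (auto simp: Lp_def in_Lp_0)
  next
    fix f g assume "f \<in> ?Y" "g \<in> ?Y"
    then obtain q r where qr: "q > p" "r > p" "in_Lp q f" "in_Lp r g" by (auto simp: Lp_def)
    let ?m = "min q r"
    have "in_Lp ?m f" "in_Lp ?m g"
      using qr(1,2) assms in_Lp_antimono[OF _ _ qr(3), of ?m] in_Lp_antimono[OF _ _ qr(4), of ?m]
      by auto
    then have "in_Lp ?m (f + g)" using qr assms by (intro in_Lp_add) auto
    then show "f + g \<in> ?Y" using qr by (auto simp: Lp_def intro!: bexI[of _ ?m])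
  next
    fix c f assume "f \<in> ?Y"
    then show "scale_L0 c f \<in> ?Y" by (auto simp: Lp_def intro: in_Lp_scale)
  qed
qed

lemma Lp_norm_truncation:
  assumes "p > 0" "q > 0" "in_Lp p f" "e > 0"
  shows "\<exists>g. in_Lp q g \<and> Lp_norm p (f - g) < e"
proof (cases "p \<ge> 1")
  case True
  obtain g where g: "in_Lp q g" "p_integral p (f - g) < e powr p"
    using p_integral_truncation[OF assms(1,2,3), of "e powr p"] assms(4) by auto
  have "p_integral p (f - g) powr (1 / p) < (e powr p) powr (1 / p)"
    using g assms by (intro powr_less_mono2) (auto simp: p_integral_nonneg)
  also have "\<dots> = e" using assms by (simp add: powr_powr)
  finally show ?thesis using g True by (auto simp: Lp_norm_def)
next
  case False
  then show ?thesis using p_integral_truncation[OF assms] by (auto simp: Lp_norm_def)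
qed

text \<open>
  The closure of a subspace is a subspace. It is stated through \<open>Lp_norm\<close>, so that only the
  approximation of basis vectors has to be checked later.
\<close>

lemma subspace_Lp_approximable:
  fixes W :: "'k::{real_normed_field, second_countable_topology} L0 set"
  assumes p: "p > 0" and W: "module.subspace scale_L0 W" "W \<subseteq> Lp p"
  shows "module.subspace scale_L0 {v \<in> Lp p. \<forall>e>0. \<exists>w\<in>W. Lp_norm p (v - w) < e}"
    (is "module.subspace _ ?K")
proof -
  interpret vector_space "scale_L0 :: 'k \<Rightarrow> _" by (rule vector_space_scale_L0)
  note Lp = subspace_Lp[OF p]
  have diff: "in_Lp p (v - w)" if "v \<in> Lp p" "w \<in> W" for v w
    using subspace_diff[OF Lp that(1)] that(2) W(2) by (auto simp: Lp_def)
  show ?thesis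
  proof (rule subspaceI)
    have "Lp_norm p (0 :: 'k L0) = 0"
      using p_integral_eq_0_iff[OF p in_Lp_0[OF p]] p by (simp add: Lp_norm_def)
    then show "0 \<in> ?K"
      using subspace_0[OF Lp] subspace_0[OF W(1)] by (auto intro!: bexI[of _ 0])
  next
    fix u v assume uv: "u \<in> ?K" "v \<in> ?K"
    show "u + v \<in> ?K"
    proof (intro CollectI conjI allI impI)
      show "u + v \<in> Lp p" using uv subspace_add[OF Lp] by blast
      fix e :: real assume e: "e > 0"
      then have e2: "e / 2 > 0" by simp
      obtain a where a: "a \<in> W" "Lp_norm p (u - a) < e / 2" using uv(1) e2 by blast
      obtain b where b: "b \<in> W" "Lp_norm p (v - b) < e / 2" using uv(2) e2 by blast
      have "Lp_norm p ((u + v) - (a + b)) \<le> Lp_norm p (u - a) + Lp_norm p (v - b)"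
        using Lp_norm_add_le[OF p diff diff, of u a v b] uv a b by (simp add: algebra_simps)
      then have "Lp_norm p ((u + v) - (a + b)) < e" using a b by linarith
      then show "\<exists>w\<in>W. Lp_norm p ((u + v) - w) < e"
        using subspace_add[OF W(1) a(1) b(1)] by blast
    qed
  next
    fix c v assume v: "v \<in> ?K"
    show "scale_L0 c v \<in> ?K"
    proof (intro CollectI conjI allI impI)
      show "scale_L0 c v \<in> Lp p" using v subspace_scale[OF Lp] by blast
      fix e :: real assume e: "e > 0"
      let ?s = "norm c powr homogeneity p"
      have s: "?s + 1 > 0" by (simp add: add_nonneg_pos)
      then have "e / (?s + 1) > 0" using e by simp
      then obtain a where a: "a \<in> W" "Lp_norm p (v - a) < e / (?s + 1)" using v by blast
      have "Lp_norm p (scale_L0 c v - scale_L0 c a) = ?s * Lp_norm p (v - a)"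
        using p by (simp add: Lp_norm_scale flip: scale_right_diff_distrib)
      also have "\<dots> \<le> ?s * (e / (?s + 1))"
        using a by (intro mult_left_mono) auto
      also have "\<dots> < e" using s e by (simp add: field_simps)
      finally show "\<exists>w\<in>W. Lp_norm p (scale_L0 c v - w) < e"
        using subspace_scale[OF W(1) a(1)] by blast
    qed
  qed
qed

lemma exists_nonzero_in_Lp:
  assumes "p > 0"
  shows "\<exists>f :: 'k::{real_normed_field, second_countable_topology} L0. in_Lp p f \<and> f \<noteq> 0"
proof (transfer fixing: p)
  have "emeasure unit_lebesgue (space unit_lebesgue) \<noteq> 0"
    by (simp add: emeasure_restrict_space)
  then have "\<not> (AE x in unit_lebesgue. (1 :: 'k) = 0)"
    using ae_filter_eq_bot_iff[of unit_lebesgue] by (simp add: trivial_limit_def)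
  then show "\<exists>f\<in>{f :: real \<Rightarrow> 'k. ae_equal f f}.
      integrable unit_lebesgue (\<lambda>x. norm (f x) powr p) \<and> \<not> ae_equal f (\<lambda>_. 0)"
    by (intro bexI[of _ "\<lambda>_. 1"]) (auto simp: ae_equal_def)
qed


section \<open>Dense-lineability of \<open>L\<^sub>p\<close> without the \<open>L\<^sub>q\<close> with \<open>q > p\<close>\<close>

text \<open>
  The scalars \<open>s n d\<close> make \<open>d + s n d T\<^sup>n\<^sup>+\<^sup>1 d\<close> converge to \<open>d\<close>. Hence the closure of the subspace \<open>W\<close>
  contains a basis of \<open>Y\<close>, so it contains \<open>Y\<close>, which is dense.
\<close>

theorem pointwise_maximal_dense_lineable_Lp:
  fixes p :: real
  assumes p: "p > 0"
  shows "pointwise_maximal_dense_lineable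
    (scale_L0 :: 'k \<Rightarrow> 'k::{real_normed_field, second_countable_topology} L0 \<Rightarrow> 'k L0)
    (Lp_topology p) (Lp p - (\<Union>q\<in>{p<..}. Lp q))"
proof -
  interpret vector_space "scale_L0 :: 'k \<Rightarrow> _" by (rule vector_space_scale_L0)
  interpret Metric_space "Lp p :: 'k L0 set" "Lp_dist p" by (rule Metric_space_Lp[OF p])
  \<comment> \<open>A vector of \<open>Lp p\<close> belongs to the set in question just when it is outside the subspace \<open>Y\<close>.\<close>
  define Y :: "'k L0 set" where "Y = (\<Union>q\<in>{p<..}. Lp q)"
  let ?T = "copies_L0 p :: 'k L0 \<Rightarrow> 'k L0"
  have Lp: "subspace (Lp p :: 'k L0 set)" by (rule subspace_Lp[OF p])
  have Y: "subspace Y" unfolding Y_def by (rule subspace_Union_Lp[OF p])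
  have YLp: "Y \<subseteq> Lp p"
    using in_Lp_antimono[of p] p by (auto simp: Y_def Lp_def intro: less_imp_le)
  have T: "?T ` Lp p \<subseteq> Lp p" using in_Lp_copies_L0[OF p] by (auto simp: Lp_def)
  have TY: "f = 0" if "?T f \<in> Y" for f
    using that in_Lp_copies_L0_imp_eq_0[OF p] by (auto simp: Y_def Lp_def)
  obtain D where D: "D \<subseteq> Y" "independent D" "Y \<subseteq> span D" by (rule maximal_independent_subset)
  have spanD: "span D = Y" using D span_minimal[OF D(1) Y] by blast
  have "\<exists>s. \<forall>n d. s n d \<noteq> 0 \<and> Lp_norm p (scale_L0 (s n d) ((?T ^^ Suc n) d)) < 1 / real (Suc n)"
    by (intro choice allI exists_small_scale p) simp
  then obtain s where s: "\<And>n d. s n d \<noteq> 0"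
    "\<And>n d. Lp_norm p (scale_L0 (s n d) ((?T ^^ Suc n) d)) < 1 / real (Suc n)" by blast
  have dense: "mtopology closure_of W = Lp p"
    if W: "subspace W" "W \<subseteq> Lp p"
      and DW: "\<And>d. d \<in> D \<Longrightarrow> \<exists>N. \<forall>n\<ge>N. d + scale_L0 (s n d) ((?T ^^ Suc n) d) \<in> W" for W
  proof -
    define K where "K = {v \<in> Lp p. \<forall>e>0. \<exists>w\<in>W. Lp_norm p (v - w) < e}"
    have "D \<subseteq> K"
    proof
      fix d assume d: "d \<in> D"
      have "\<exists>w\<in>W. Lp_norm p (d - w) < e" if "e > 0" for e
      proof -
        obtain N where N: "\<forall>n\<ge>N. d + scale_L0 (s n d) ((?T ^^ Suc n) d) \<in> W" using DW[OF d] by blast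
        obtain m where m: "1 / real (Suc m) < e" using \<open>e > 0\<close> nat_approx_posE by blast
        let ?n = "max N m"
        let ?x = "scale_L0 (s ?n d) ((?T ^^ Suc ?n) d)"
        have "Lp_norm p (d - (d + ?x)) = Lp_norm p ?x"
          by (simp add: Lp_norm_def p_integral_minus)
        also have "\<dots> < 1 / real (Suc ?n)" by (rule s(2))
        also have "\<dots> \<le> 1 / real (Suc m)" by (intro divide_left_mono) auto
        also have "\<dots> < e" by (rule m)
        finally show ?thesis using N by (meson max.cobounded1)
      qed
      then show "d \<in> K" using d D(1) YLp by (auto simp: K_def)
    qed
    then have YK: "Y \<subseteq> K"
      unfolding spanD[symmetric] K_def
      by (rule span_minimal) (rule subspace_Lp_approximable[OF p W])
    have "\<exists>w\<in>W. w \<in> mball v e" if v: "v \<in> Lp p" and e: "e > 0" for v e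
    proof -
      have e2: "e / 2 > 0" using e by simp
      obtain y where y: "in_Lp (p + 1) y" "Lp_norm p (v - y) < e / 2"
        using Lp_norm_truncation[OF p _ _ e2, of "p + 1" v] v p by (auto simp: Lp_def)
      have yY: "y \<in> Y" using y(1) by (auto simp: Y_def Lp_def intro!: bexI[of _ "p + 1"])
      then have "\<forall>e>0. \<exists>w\<in>W. Lp_norm p (y - w) < e" using YK by (auto simp: K_def)
      then obtain w where w: "w \<in> W" "Lp_norm p (y - w) < e / 2" using e2 by blast
      have in_Lp: "y \<in> Lp p" "w \<in> Lp p" using yY YLp w(1) W(2) by auto
      have "Lp_dist p v w \<le> Lp_dist p v y + Lp_dist p y w"
        using v in_Lp by (intro triangle)
      then have "Lp_dist p v w < e" using y w by (simp add: Lp_dist_def)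
      then show ?thesis using v w(1) in_Lp by auto
    qed
    then show ?thesis unfolding metric_closure_of by blast
  qed
  have top: "Lp_topology p = (mtopology :: 'k L0 topology)" by (simp add: Lp_topology_def)
  show ?thesis
    unfolding pointwise_maximal_dense_lineable_def topspace_Lp_topology[OF p] Y_def[symmetric]
  proof (intro conjI ballI)
    obtain f :: "'k L0" where f: "f \<in> Lp p" "f \<noteq> 0"
      using exists_nonzero_in_Lp[OF p] by (auto simp: Lp_def)
    then have "?T f \<in> Lp p - Y" using T TY by blast
    then show "Lp p - Y \<noteq> {}" by blast
  next
    show "Lp p - Y \<subseteq> Lp p" by blast
  next
    fix f assume f: "f \<in> Lp p - Y"
    obtain W where W: "subspace W" "W \<subseteq> Lp p" "W \<inter> Y \<subseteq> {0}" "f \<in> W"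
      "same_hamel_dim scale_L0 W (Lp p)"
      "\<And>d. d \<in> D \<Longrightarrow> \<exists>N. \<forall>n\<ge>N. d + scale_L0 (s n d) ((?T ^^ Suc n) d) \<in> W"
      using exists_approximating_complement[OF linear_copies_L0 Lp YLp T TY _ _ D(2) spanD, of f s] f s(1)
      by blast
    show "\<exists>W. subspace W \<and> Lp_topology p closure_of W = Lp p \<and> same_hamel_dim scale_L0 W (Lp p) \<and>
        f \<in> W \<and> W \<subseteq> Lp p - Y \<union> {0}"
      using W dense[OF W(1,2,6)] unfolding top by (intro exI[of _ W]) blast
  qed
qed

theorem corollary5p4:
  fixes p :: real
  assumes "p > 0"
  shows "pointwise_maximal_dense_lineable (scale_L0 :: real \<Rightarrow> real L0 \<Rightarrow> real L0)
           (Lp_topology p) (Lp p - (\<Union>q\<in>{p<..}. Lp q)) \<and>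
         pointwise_maximal_dense_lineable (scale_L0 :: complex \<Rightarrow> complex L0 \<Rightarrow> complex L0)
           (Lp_topology p) (Lp p - (\<Union>q\<in>{p<..}. Lp q))"
  by (intro conjI pointwise_maximal_dense_lineable_Lp assms)

end
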